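(* Let $\mathcal{B}=B(F)\subseteq 2^{[n]}$ be a principal Borel set with Borel generator $F=\{i_1<i_2<\cdots<i_d\}$, and let $\Delta$ be the simplicial complex on $[n]$ with $\mathcal{F}(\Delta)=\mathcal{B}$. Then the $S$-algebra $B(\Delta)$ is generated by the elements $x_Ht^k$, for $k=1,\ldots,d$, where $$H\in B\big(\{q,q+1,\ldots,i_{k+q-1}\} : q=1,\ldots,d-k+1\big).$$
   Context: Let $K$ be a field, $[n]=\{1,\ldots,n\}$, $S=K[x_1,\ldots,x_n]$, and $x_H=\prod_{i\in H}x_i$ for $H\subseteq[n]$. A subset $\mathcal{B}\subseteq 2^{[n]}$ is Borel if whenever $F\in\mathcal{B}$, $i<j$, $i\in[n]\setminus F$ and $j\in F$, then $(F\setminus\{j\})\cup\{i\}\in\mathcal{B}$. For subsets $F_1,\ldots,F_m$ of $[n]$ (possibly of different cardinalities), $B(F_1,\ldots,F_m)$ denotes the smallest Borel subset of $2^{[n]}$ containing $F_1,\ldots,F_m$; these are called its Borel generators, and a Borel set is principal if it equals $B(F)$ for some $F$. $B(G_q : q=1,\ldots,s)$ means $B(G_1,\ldots,G_s)$. $\mathcal{F}(\Delta)$ is the set of facets (maximal faces) of $\Delta$. For $k\ge 0$, a $k$-cover of $\Delta$ is a nonzero vector $c\in\mathbb{Z}_{\ge 0}^n$ with $\sum_{i\in G}c_i\ge k$ for every facet $G$; it is squarefree if all $c_i\le 1$. $B(\Delta)\subseteq S[t]$ is the $S$-subalgebra generated by all $x^ct^k$ with $k\ge 1$ and $c$ a squarefree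 $k$-cover of $\Delta$, where $x^c=x_1^{c_1}\cdots x_n^{c_n}$. *)

theory Defs
  imports "HOL-Library.Poly_Mapping" "HOL-Computational_Algebra.Polynomial"
begin

definition is_borel :: "nat \<Rightarrow> nat set set \<Rightarrow> bool" where
  "is_borel n \<B> \<longleftrightarrow> \<B> \<subseteq> Pow {1..n} \<and>
     (\<forall>F\<in>\<B>. \<forall>i\<in>{1..n} - F. \<forall>j\<in>F. i < j \<longrightarrow> (F - {j}) \<union> {i} \<in> \<B>)"

text \<open>The smallest Borel subset of \<open>2\<^sup>[\<^sup>n\<^sup>]\<close> containing a family \<open>\<G>\<close> of subsets of \<open>[n]\<close>.
  As a hull it is meaningful only when all members of \<open>\<G>\<close> are subsets of \<open>{1..n}\<close>;
  otherwise it is the intersection of an empty family.\<close>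

definition borel_generated :: "nat \<Rightarrow> nat set set \<Rightarrow> nat set set" where
  "borel_generated n \<G> = is_borel n hull \<G>"

text \<open>The void complex and vertices \<open>i\<close> with \<open>{i} \<notin> \<Delta>\<close> are allowed.\<close>

definition simplicial_complex :: "nat \<Rightarrow> nat set set \<Rightarrow> bool" where
  "simplicial_complex n \<Delta> \<longleftrightarrow> \<Delta> \<subseteq> Pow {1..n} \<and> (\<forall>F\<in>\<Delta>. \<forall>G. G \<subseteq> F \<longrightarrow> G \<in> \<Delta>)"

definition facets :: "nat set set \<Rightarrow> nat set set" where
  "facets \<Delta> = {F \<in> \<Delta>. \<forall>G\<in>\<Delta>. F \<subseteq> G \<longrightarrow> G = F}"

text \<open>Vectors in \<open>\<int>\<^sub>\<ge>\<^sub>0\<^sup>n\<close> are functions on \<open>nat\<close> vanishing outside \<open>{1..n}\<close>.\<close>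

definition is_cover :: "nat \<Rightarrow> nat set set \<Rightarrow> nat \<Rightarrow> (nat \<Rightarrow> nat) \<Rightarrow> bool" where
  "is_cover n \<Delta> k c \<longleftrightarrow> (\<forall>i. i \<notin> {1..n} \<longrightarrow> c i = 0) \<and> (\<exists>i. c i \<noteq> 0) \<and>
     (\<forall>G\<in>facets \<Delta>. k \<le> (\<Sum>i\<in>G. c i))"

definition squarefree_cover :: "nat \<Rightarrow> nat set set \<Rightarrow> nat \<Rightarrow> (nat \<Rightarrow> nat) \<Rightarrow> bool" where
  "squarefree_cover n \<Delta> k c \<longleftrightarrow> is_cover n \<Delta> k c \<and> (\<forall>i. c i \<le> 1)"

text \<open>Polynomials in variables \<open>x\<^sub>0, x\<^sub>1, x\<^sub>2, \<dots>\<close>: finitely supported maps from exponent vectors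
  to coefficients, with the convolution product. The ring \<open>S = K[x\<^sub>1,\<dots>,x\<^sub>n]\<close> is the subset
  \<open>poly_ring n\<close>, and \<open>S[t]\<close> consists of the univariate polynomials with coefficients in it.\<close>

type_synonym 'k mpol = "(nat \<Rightarrow>\<^sub>0 nat) \<Rightarrow>\<^sub>0 'k"

definition poly_ring :: "nat \<Rightarrow> 'k::field mpol set" where
  "poly_ring n = {p. \<forall>m\<in>Poly_Mapping.keys p. Poly_Mapping.keys m \<subseteq> {1..n}}"

definition poly_ring_t :: "nat \<Rightarrow> 'k::field mpol poly set" where
  "poly_ring_t n = {f. \<forall>k. coeff f k \<in> poly_ring n}"

definition var :: "nat \<Rightarrow> 'k::field mpol" where
  "var i = Poly_Mapping.single (Poly_Mapping.single i 1) 1"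

definition x_set :: "nat set \<Rightarrow> 'k::field mpol" where
  "x_set H = (\<Prod>i\<in>H. var i)"

definition x_pow :: "nat \<Rightarrow> (nat \<Rightarrow> nat) \<Rightarrow> 'k::field mpol" where
  "x_pow n c = (\<Prod>i\<in>{1..n}. var i ^ c i)"

definition is_subalgebra :: "nat \<Rightarrow> 'k::field mpol poly set \<Rightarrow> bool" where
  "is_subalgebra n A \<longleftrightarrow> A \<subseteq> poly_ring_t n \<and> 1 \<in> A \<and>
     (\<forall>f\<in>A. \<forall>g\<in>A. f + g \<in> A \<and> f * g \<in> A) \<and>
     (\<forall>s\<in>poly_ring n. \<forall>f\<in>A. smult s f \<in> A)"

text \<open>The \<open>S\<close>-subalgebra of \<open>S[t]\<close> generated by a set \<open>X \<subseteq> S[t]\<close>.\<close>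

definition subalgebra_generated :: "nat \<Rightarrow> 'k::field mpol poly set \<Rightarrow> 'k mpol poly set" where
  "subalgebra_generated n X = is_subalgebra n hull X"

text \<open>The algebra \<open>B(\<Delta>)\<close>; \<open>monom s k\<close> is \<open>s t\<^sup>k\<close>.\<close>

definition cover_algebra :: "nat \<Rightarrow> nat set set \<Rightarrow> 'k::field mpol poly set" where
  "cover_algebra n \<Delta> =
     subalgebra_generated n {monom (x_pow n c) k |c k. k \<ge> 1 \<and> squarefree_cover n \<Delta> k c}"

end

theory Submission
  imports Defs
begin

text \<open>
  A principal Borel set \<open>B(F)\<close> is the down-set of \<open>F\<close> in the Gale order: it consists of the
  \<open>|F|\<close>-subsets \<open>G\<close> of \<open>[n]\<close> that have at least as many elements as \<open>F\<close> in every initial segment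
  \<open>[x]\<close> (\<open>borel_generated_eq_gale\<close>). Two consequences carry the proof.

  For \<open>k \<ge> 1\<close>, the squarefree \<open>k\<close>-covers are the indicator vectors of the sets \<open>C\<close> that meet every
  \<open>G \<in> B(F)\<close> in at least \<open>k\<close> elements. If some initial segment satisfies
  \<open>|[x] - C| + k \<le> |F \<inter> [x]|\<close>, then \<open>C\<close> is such a set, because \<open>G\<close> has at least
  \<open>|F \<inter> [x]|\<close> elements in \<open>[x]\<close> and at most \<open>|[x] - C|\<close> of them are outside \<open>C\<close>. If no
  initial segment does, then a \<open>G \<in> B(F)\<close> that meets \<open>C\<close> in fewer than \<open>k\<close> elements can be
  assembled from the smallest elements outside \<open>C\<close> and \<open>k - 1\<close> further small elements
  (\<open>principal_borel_cover_iff\<close>). The segment may be shrunk to one that ends in an element of \<open>F\<close>,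
  say \<open>x = i\<^sub>r\<close> with \<open>r = k + q - 1\<close>; the condition then says that \<open>C\<close> misses at most
  \<open>q - 1\<close> elements of \<open>[i\<^sub>r]\<close>.

  For an interval, the Gale condition reduces to its last instance: \<open>B({q..p})\<close> consists of all
  subsets of \<open>[p]\<close> with \<open>q - 1\<close> elements of \<open>[p]\<close> left out (\<open>gale_le_atLeastAtMost_iff\<close>).
  So the sets \<open>H\<close> of the theorem are \<open>k\<close>-covers, and every squarefree \<open>k\<close>-cover contains one of
  them. A generator \<open>x\<^sub>C t\<^sup>k\<close> of \<open>B(\<Delta>)\<close> is therefore the multiple of some \<open>x\<^sub>H t\<^sup>k\<close> by the
  monomial \<open>x\<^bsub>C - H\<^esub>\<close>, a scalar in \<open>S\<close>.
\<close>

section \<open>Principal Borel sets and the Gale order\<close>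

text \<open>
  The Gale order compares sorted sets of equal size entry by entry. Counting elements in initial
  segments expresses this without sorting: the \<open>r\<close>-th element of \<open>G\<close> is at most that of \<open>F\<close> for all
  \<open>r\<close> iff no initial segment contains more of \<open>F\<close> than of \<open>G\<close>.
\<close>

definition gale_le :: "nat set \<Rightarrow> nat set \<Rightarrow> bool" where
  "gale_le G F \<longleftrightarrow> card G = card F \<and> (\<forall>x. card (F \<inter> {..x}) \<le> card (G \<inter> {..x}))"

lemma card_exchange:
  assumes "finite S" "a \<notin> S" "b \<in> S"
  shows "card (insert a (S - {b})) = card S"
  using assms card.remove[of S b] by simp

lemma gale_le_exchange:
  assumes "finite G" "a \<notin> G" "b \<in> G" "a < b"
  shows "gale_le ((G - {b}) \<union> {a}) G"
proof -
  have "card (G \<inter> {..x}) \<le> card (((G - {b}) \<union> {a}) \<inter> {..x})" for x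
  proof (cases "b \<le> x")
    case True
    have "((G - {b}) \<union> {a}) \<inter> {..x} = insert a (G \<inter> {..x} - {b})"
      using True assms by auto
    moreover have "card (insert a (G \<inter> {..x} - {b})) = card (G \<inter> {..x})"
      using True assms by (intro card_exchange) auto
    ultimately show ?thesis by simp
  next
    case False
    then show ?thesis using assms by (intro card_mono) auto
  qed
  moreover have "card ((G - {b}) \<union> {a}) = card G"
    using assms card_exchange[of G a b] by simp
  ultimately show ?thesis by (simp add: gale_le_def)
qed

lemma gale_le_trans: "gale_le H G \<Longrightarrow> gale_le G F \<Longrightarrow> gale_le H F"
  unfolding gale_le_def by (metis order_trans)

text \<open>
  One Borel move brings \<open>F\<close> closer to \<open>G\<close>. Take the least \<open>b \<in> F - G\<close>. Since \<open>F\<close> has no more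
  elements than \<open>G\<close> up to \<open>b\<close>, some \<open>a < b\<close> lies in \<open>G - F\<close>. Exchanging \<open>b\<close> for \<open>a\<close> keeps \<open>F\<close>
  above \<open>G\<close>: only the counts on segments ending in \<open>[a, b)\<close> change, and below \<open>b\<close> the new set is
  contained in \<open>G\<close>.
\<close>

lemma borel_down_closed:
  assumes "is_borel n \<B>" "F \<in> \<B>" "G \<subseteq> {1..n}" "gale_le G F"
  shows "G \<in> \<B>"
  using assms(2,4)
proof (induction "card (F - G)" arbitrary: F rule: less_induct)
  case less
  have Fn: "F \<subseteq> {1..n}" using assms(1) less.prems(1) by (auto simp: is_borel_def)
  have fin: "finite F" "finite G" using Fn assms(3) finite_subset by blast+
  have card: "card G = card F"
    and le: "\<And>x. card (F \<inter> {..x}) \<le> card (G \<inter> {..x})"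
    using less.prems(2) by (auto simp: gale_le_def)
  show ?case
  proof (cases "F = G")
    case True
    then show ?thesis using less.prems by simp
  next
    case False
    have "F - G \<noteq> {}"
      using False card card_subset_eq[of G F] fin by auto
    define b where "b = Min (F - G)"
    have b: "b \<in> F" "b \<notin> G"
      using Min_in[of "F - G"] \<open>F - G \<noteq> {}\<close> fin by (auto simp: b_def)
    have b_least: "z \<in> G" if "z \<in> F" "z < b" for z
      using that fin Min_le[of "F - G" z] by (auto simp: b_def not_le[symmetric])
    have "\<exists>a\<in>G - F. a < b"
    proof (rule ccontr)
      assume "\<not> ?thesis"
      then have "G \<inter> {..b} \<subseteq> F \<inter> {..b} - {b}" using b by (force simp: le_less)
      then have "card (G \<inter> {..b}) \<le> card (F \<inter> {..b} - {b})"
        by (intro card_mono) auto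
      also have "\<dots> < card (F \<inter> {..b})" using b by (intro card_Diff1_less) auto
      finally show False using le[of b] by simp
    qed
    then obtain a where a: "a \<in> G" "a \<notin> F" "a < b" by auto
    let ?F' = "(F - {b}) \<union> {a}"
    have mem: "?F' \<in> \<B>"
      using assms(1,3) less.prems(1) a b unfolding is_borel_def by blast
    have "card (?F' \<inter> {..x}) \<le> card (G \<inter> {..x})" for x
    proof (cases "b \<le> x")
      case True
      have "?F' \<inter> {..x} = insert a (F \<inter> {..x} - {b})" using True a by auto
      moreover have "card (insert a (F \<inter> {..x} - {b})) = card (F \<inter> {..x})"
        using True a b by (intro card_exchange) auto
      ultimately show ?thesis using le[of x] by simp
    next
      case False
      then show ?thesis using a b_least by (intro card_mono) auto
    qed
    moreover have "card ?F' = card F" using fin a b card_exchange[of F a b] by simp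
    ultimately have "gale_le G ?F'" using card by (simp add: gale_le_def)
    moreover have "card (?F' - G) < card (F - G)"
      using a b fin by (intro psubset_card_mono) auto
    ultimately show ?thesis using less.hyps mem by blast
  qed
qed

lemma is_borel_gale_down: "is_borel n {G. G \<subseteq> {1..n} \<and> (\<exists>F\<in>\<G>. gale_le G F)}"
  unfolding is_borel_def
proof (intro conjI ballI impI)
  fix G a b
  assume G: "G \<in> {G. G \<subseteq> {1..n} \<and> (\<exists>F\<in>\<G>. gale_le G F)}"
    and ab: "a \<in> {1..n} - G" "b \<in> G" "a < b"
  have "finite G" using G finite_subset by blast
  then have "gale_le (G - {b} \<union> {a}) G" using ab by (intro gale_le_exchange) auto
  then show "G - {b} \<union> {a} \<in> {G. G \<subseteq> {1..n} \<and> (\<exists>F\<in>\<G>. gale_le G F)}"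
    using G ab by (auto intro: gale_le_trans)
qed auto

lemma borel_generated_eq_gale:
  assumes "\<G> \<subseteq> Pow {1..n}"
  shows "borel_generated n \<G> = {G. G \<subseteq> {1..n} \<and> (\<exists>F\<in>\<G>. gale_le G F)}" (is "_ = ?R")
proof
  have "\<G> \<subseteq> ?R" using assms by (auto simp: gale_le_def)
  then show "borel_generated n \<G> \<subseteq> ?R"
    unfolding borel_generated_def by (intro hull_minimal is_borel_gale_down)
  show "?R \<subseteq> borel_generated n \<G>"
    unfolding borel_generated_def hull_def by (blast intro: borel_down_closed)
qed

text \<open>
  A subset of \<open>[p]\<close> that leaves out \<open>q - 1\<close> elements leaves out at most \<open>q - 1\<close> elements of every
  \<open>[x]\<close> with \<open>x \<le> p\<close>, and \<open>{q..p}\<close> leaves out that many as soon as \<open>x \<ge> q - 1\<close>.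
\<close>

lemma gale_le_atLeastAtMost_iff:
  assumes "H \<subseteq> {1..n}" "q \<ge> 1" "q \<le> p"
  shows "gale_le H {q..p} \<longleftrightarrow> H \<subseteq> {1..p} \<and> card H = p + 1 - q"
proof
  have fin: "finite H" using assms finite_subset by blast
  assume H: "gale_le H {q..p}"
  have "card ({q..p} \<inter> {..p}) \<le> card (H \<inter> {..p})" using H unfolding gale_le_def by blast
  moreover have "{q..p} \<inter> {..p} = {q..p}" by auto
  ultimately have "card H \<le> card (H \<inter> {..p})" using H unfolding gale_le_def by metis
  then have "H \<inter> {..p} = H" using fin by (intro card_seteq) auto
  then have "H \<subseteq> {1..n} \<inter> {..p}" using assms(1) by blast
  then show "H \<subseteq> {1..p} \<and> card H = p + 1 - q" using H by (auto simp: gale_le_def)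
next
  assume H: "H \<subseteq> {1..p} \<and> card H = p + 1 - q"
  have "card ({q..p} \<inter> {..x}) \<le> card (H \<inter> {..x})" for x
  proof (cases "x < p")
    case True
    have "{q..p} \<inter> {..x} = {q..x}" using True by auto
    moreover have "card H \<le> card (H \<inter> {..x} \<union> {x<..p})"
      using H by (intro card_mono) auto
    then have "card H \<le> card (H \<inter> {..x}) + (p - x)"
      using card_Un_le[of "H \<inter> {..x}" "{x<..p}"] by simp
    ultimately show ?thesis using H True assms by auto
  next
    case False
    then have "{q..p} \<inter> {..x} = {q..p}" "H \<inter> {..x} = H" using H by auto
    then show ?thesis using H by simp
  qed
  then show "gale_le H {q..p}" using H by (simp add: gale_le_def)
qed

section \<open>Covers of a principal Borel set\<close>

lemma exists_smallest_elements:
  fixes S :: "nat set"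
  assumes "finite S" "m \<le> card S"
  shows "\<exists>A\<subseteq>S. card A = m \<and> (\<forall>x. card (A \<inter> {..x}) = min m (card (S \<inter> {..x})))"
  using assms
proof (induction S rule: finite_linorder_max_induct)
  case empty
  then show ?case by auto
next
  case (insert b S)
  have b: "b \<notin> S" using insert.hyps by auto
  show ?case
  proof (cases "m = card (insert b S)")
    case True
    have "card (insert b S \<inter> {..x}) \<le> card (insert b S)" for x
      using insert.hyps by (intro card_mono) auto
    then show ?thesis using True by (intro exI[of _ "insert b S"]) (simp add: min_absorb2)
  next
    case False
    then have m: "m \<le> card S" using insert b by simp
    then obtain A where A: "A \<subseteq> S" "card A = m"
      "\<And>x. card (A \<inter> {..x}) = min m (card (S \<inter> {..x}))"
      using insert.IH by blast
    have "min m (card (S \<inter> {..x})) = min m (card (insert b S \<inter> {..x}))" for x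
    proof (cases "b \<le> x")
      case True
      then have "S \<inter> {..x} = S" "insert b S \<inter> {..x} = insert b S" using insert.hyps by auto
      then show ?thesis using m b insert.hyps by simp
    next
      case False
      then have "insert b S \<inter> {..x} = S \<inter> {..x}" by auto
      then show ?thesis by simp
    qed
    then show ?thesis using A by (intro exI[of _ A]) auto
  qed
qed

text \<open>
  If \<open>|F| < k\<close>, then \<open>F\<close> itself will do. Otherwise every \<open>G\<close> of size \<open>|F|\<close> with
  \<open>|C \<inter> G| < k\<close> needs at least \<open>m = |F| - k + 1\<close> elements outside \<open>C\<close>. To get low in the Gale order, \<open>G\<close> takes the \<open>m\<close> smallest of them, together with the \<open>k - 1\<close>
  smallest remaining elements of \<open>[n]\<close>.
\<close>

lemma exists_gale_le_avoiding:
  assumes F: "F \<subseteq> {1..n}" and k: "1 \<le> k"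
    and few: "\<And>x. card (F \<inter> {..x}) < card ({1..x} - C) + k"
  shows "\<exists>G\<subseteq>{1..n}. gale_le G F \<and> card (C \<inter> G) < k"
proof (cases "card F < k")
  case True
  have "card (C \<inter> F) \<le> card F" using F finite_subset by (intro card_mono) auto
  then show ?thesis using True F by (intro exI[of _ F]) (auto simp: gale_le_def)
next
  case False
  define m where "m = card F - k + 1"
  have Fle: "F \<inter> {..n} = F" using F by auto
  have cFn: "card F \<le> n" using card_mono[OF _ F] by simp
  have "m \<le> card ({1..n} - C)" using few[of n] False by (simp add: Fle m_def)
  then obtain A where A: "A \<subseteq> {1..n} - C" "card A = m"
    and Ax: "\<And>x. card (A \<inter> {..x}) = min m (card (({1..n} - C) \<inter> {..x}))"
    using exists_smallest_elements[of "{1..n} - C" m] by auto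
  have finA: "finite A" using A finite_subset by blast
  have An: "A \<subseteq> {1..n}" using A by auto
  have "k - 1 \<le> card ({1..n} - A)"
    using A An finA cFn False k by (simp add: card_Diff_subset m_def)
  then obtain L where L: "L \<subseteq> {1..n} - A" "card L = k - 1"
    and Lx: "\<And>x. card (L \<inter> {..x}) = min (k - 1) (card (({1..n} - A) \<inter> {..x}))"
    using exists_smallest_elements[of "{1..n} - A" "k - 1"] by auto
  have finL: "finite L" using L finite_subset by blast
  have disj: "A \<inter> L = {}" using L by auto
  have cardG: "card (A \<union> L) = card F"
    using disj finA finL A L False k by (simp add: card_Un_disjoint m_def)
  have "card (F \<inter> {..x}) \<le> card ((A \<union> L) \<inter> {..x})" for x
  proof (cases "x \<le> n")
    case True
    have "({1..n} - C) \<inter> {..x} = {1..x} - C" using True by auto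
    then have a: "card (A \<inter> {..x}) = min m (card ({1..x} - C))" using Ax by simp
    have "({1..n} - A) \<inter> {..x} = {1..x} - A \<inter> {..x}" using True by auto
    moreover have "card ({1..x} - A \<inter> {..x}) = x - card (A \<inter> {..x})"
      using finA An by (subst card_Diff_subset) auto
    ultimately have l: "card (L \<inter> {..x}) = min (k - 1) (x - card (A \<inter> {..x}))"
      using Lx by simp
    have "(A \<union> L) \<inter> {..x} = A \<inter> {..x} \<union> L \<inter> {..x}" by auto
    then have g: "card ((A \<union> L) \<inter> {..x}) = card (A \<inter> {..x}) + card (L \<inter> {..x})"
      using disj by (simp add: card_Un_disjoint disjoint_iff)
    have "card (F \<inter> {..x}) \<le> card {1..x}" using F by (intro card_mono) auto
    \<comment> \<open>The two bounds cover the two values of \<open>card (L \<inter> {..x})\<close>: the first, where \<open>A \<union> L\<close>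
      fills \<open>[x]\<close>; the second, where all of \<open>L\<close> lies in \<open>[x]\<close>.\<close>
    then have "card (F \<inter> {..x}) \<le> card (A \<inter> {..x}) + (x - card (A \<inter> {..x}))"
      by simp
    moreover have "card (F \<inter> {..x}) \<le> card F"
      using F finite_subset by (intro card_mono) auto
    then have "card (F \<inter> {..x}) \<le> m + (k - 1)" using False k by (simp add: m_def)
    then have "card (F \<inter> {..x}) \<le> card (A \<inter> {..x}) + (k - 1)"
      using few[of x] k unfolding a
      by (cases "m \<le> card ({1..x} - C)") (simp_all add: min_def)
    ultimately show ?thesis unfolding g l by (simp add: min_def)
  next
    case False
    then have "F \<inter> {..x} = F" "(A \<union> L) \<inter> {..x} = A \<union> L" using F An L by auto
    then show ?thesis using cardG by simp
  qed
  then have "gale_le (A \<union> L) F" using cardG by (simp add: gale_le_def)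
  moreover have "card (C \<inter> (A \<union> L)) \<le> card L" using A finL by (intro card_mono) auto
  ultimately show ?thesis using A L k by (intro exI[of _ "A \<union> L"]) auto
qed

lemma principal_borel_cover_iff:
  assumes F: "F \<subseteq> {1..n}" and k: "1 \<le> k"
  shows "(\<forall>G\<in>borel_generated n {F}. k \<le> card (C \<inter> G)) \<longleftrightarrow>
    (\<exists>x. card ({1..x} - C) + k \<le> card (F \<inter> {..x}))" (is "?L \<longleftrightarrow> ?R")
proof
  assume ?L
  then show ?R
    using exists_gale_le_avoiding[OF F k, of C] F
    by (auto simp: borel_generated_eq_gale not_less[symmetric])
next
  assume ?R
  then obtain x where x: "card ({1..x} - C) + k \<le> card (F \<inter> {..x})" by blast
  show ?L
  proof
    fix G assume "G \<in> borel_generated n {F}"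
    then have G: "G \<subseteq> {1..n}" "gale_le G F" using F by (auto simp: borel_generated_eq_gale)
    have fin: "finite G" using G finite_subset by blast
    have "card (G \<inter> {..x}) \<le> card (({1..x} - C) \<union> (C \<inter> G))"
      using G fin by (intro card_mono) auto
    also have "\<dots> \<le> card ({1..x} - C) + card (C \<inter> G)" by (rule card_Un_le)
    finally show "k \<le> card (C \<inter> G)" using x G(2) unfolding gale_le_def
      by (metis add_le_cancel_left order_trans)
  qed
qed

lemma card_strict_mono_image_atMost:
  fixes i :: "nat \<Rightarrow> nat"
  assumes i: "strict_mono_on {1..d} i" and r: "r \<in> {1..d}"
  shows "card (i ` {1..d} \<inter> {..i r}) = r"
proof -
  have "i ` {1..d} \<inter> {..i r} = i ` {1..r}"
    using r strict_mono_on_less_eq[OF i] by (auto simp: image_iff)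
  moreover have "inj_on i {1..r}"
    using r by (intro inj_on_subset[OF strict_mono_on_imp_inj_on[OF i]]) auto
  ultimately show ?thesis by (simp add: card_image)
qed

text \<open>
  This allows an arbitrary segment \<open>[x]\<close> to be shrunk to \<open>[i\<^sub>r]\<close>: the two contain the same
  \<open>r\<close> elements of the image of \<open>i\<close>.
\<close>

lemma strict_mono_image_card_le:
  fixes i :: "nat \<Rightarrow> nat"
  assumes i: "strict_mono_on {1..d} i" and r: "r = card (i ` {1..d} \<inter> {..x})" "1 \<le> r"
  shows "r \<le> d" "i r \<le> x"
proof -
  have "r \<le> card (i ` {1..d})" unfolding r by (intro card_mono) auto
  also have "\<dots> \<le> d" using card_image_le[of "{1..d}" i] by simp
  finally show rd: "r \<le> d" .
  show "i r \<le> x"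
  proof (rule ccontr)
    assume "\<not> i r \<le> x"
    then have "i ` {1..d} \<inter> {..x} \<subseteq> i ` {1..<r}"
      using strict_mono_on_less_eq[OF i, of r] r(2) rd by fastforce
    then have "r \<le> card (i ` {1..<r})" unfolding r(1) by (intro card_mono) auto
    also have "\<dots> \<le> r - 1" using card_image_le[of "{1..<r}" i] by simp
    finally show False using r(2) by simp
  qed
qed

section \<open>Squarefree monomials\<close>

lemma x_set_in_poly_ring:
  assumes "H \<subseteq> {1..n}"
  shows "(x_set H :: 'k::field mpol) \<in> poly_ring n"
proof -
  have "finite H" using assms finite_subset by blast
  then have "\<exists>m. x_set H = (Poly_Mapping.single m 1 :: 'k mpol) \<and> Poly_Mapping.keys m \<subseteq> H"
  proof (induction H)
    case empty
    show ?case by (rule exI[of _ 0]) (simp add: x_set_def)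
  next
    case (insert a H)
    then obtain m where m: "x_set H = (Poly_Mapping.single m 1 :: 'k mpol)"
      "Poly_Mapping.keys m \<subseteq> H" by blast
    have "x_set (insert a H) = (Poly_Mapping.single (Poly_Mapping.single a 1 + m) 1 :: 'k mpol)"
      using insert.hyps m by (simp add: x_set_def var_def mult_single)
    moreover have "Poly_Mapping.keys (Poly_Mapping.single a 1 + m) \<subseteq> insert a H"
      using m Poly_Mapping.keys_add[of "Poly_Mapping.single a 1" m] by auto
    ultimately show ?case by blast
  qed
  then show ?thesis using assms by (auto simp: poly_ring_def)
qed

lemma x_pow_squarefree:
  assumes "\<And>j. c j \<le> 1" "{j. c j \<noteq> 0} \<subseteq> {1..n}"
  shows "x_pow n c = (x_set {j. c j \<noteq> 0} :: 'k::field mpol)"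
proof -
  have "var j ^ c j = (if c j \<noteq> 0 then var j else 1 :: 'k mpol)" for j
    using assms(1)[of j] by (cases "c j") auto
  then have "x_pow n c = (\<Prod>j\<in>{1..n}. if c j \<noteq> 0 then var j else 1 :: 'k mpol)"
    by (simp add: x_pow_def)
  also have "\<dots> = (\<Prod>j\<in>{j. c j \<noteq> 0}. var j)"
    using assms(2) by (intro prod.mono_neutral_cong_right) simp_all
  finally show ?thesis by (simp add: x_set_def)
qed

lemma sum_squarefree:
  fixes c :: "nat \<Rightarrow> nat"
  assumes "\<And>j. c j \<le> 1" "finite G"
  shows "sum c G = card ({j. c j \<noteq> 0} \<inter> G)"
proof -
  have "c j = 1" if "c j \<noteq> 0" for j
    using assms(1)[of j] that by simp
  then have "sum c G = (\<Sum>j\<in>{j. c j \<noteq> 0} \<inter> G. 1)"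
    using assms(2) by (intro sum.mono_neutral_cong_right) auto
  then show ?thesis by simp
qed

theorem proposition3p3:
  fixes n d :: nat and i :: "nat \<Rightarrow> nat" and F :: "nat set" and \<B> \<Delta> :: "nat set set"
  assumes "F \<subseteq> {1..n}"
    and "strict_mono_on {1..d} i"
    and "F = i ` {1..d}"
    and "\<B> = borel_generated n {F}"
    and "simplicial_complex n \<Delta>"
    and "facets \<Delta> = \<B>"
  shows "(cover_algebra n \<Delta> :: 'k::field mpol poly set) =
    subalgebra_generated n {monom (x_set H) k |H k. k \<in> {1..d} \<and>
      H \<in> borel_generated n {{q..i (k + q - 1)} |q. q \<in> {1..d - k + 1}}}"
proof -
  let ?X = "{monom (x_pow n c) k |c k. k \<ge> 1 \<and> squarefree_cover n \<Delta> k c} :: 'k mpol poly set"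
  let ?Y = "{monom (x_set H) k |H k. k \<in> {1..d} \<and>
      H \<in> borel_generated n {{q..i (k + q - 1)} |q. q \<in> {1..d - k + 1}}} :: 'k mpol poly set"
  have facet_sub: "G \<subseteq> {1..n}" if "G \<in> \<B>" for G
    using that assms(1,4) by (auto simp: borel_generated_eq_gale)
  then have facet_fin: "finite G" if "G \<in> \<B>" for G
    using that finite_subset by blast
  have cover_iff: "(\<forall>G\<in>facets \<Delta>. k \<le> sum c G) \<longleftrightarrow>
      (\<exists>x. card ({1..x} - {j. c j \<noteq> 0}) + k \<le> card (F \<inter> {..x}))"
    if "1 \<le> k" "\<And>j. c j \<le> 1" for k and c :: "nat \<Rightarrow> nat"
    using principal_borel_cover_iff[OF assms(1) that(1), of "{j. c j \<noteq> 0}"]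
      sum_squarefree[of c, OF that(2)] facet_fin assms(4,6) by simp
  have rank: "card (F \<inter> {..i r}) = r" and i_le: "i r \<le> n" and le_i: "r \<le> i r"
    if "r \<in> {1..d}" for r
  proof -
    show r: "card (F \<inter> {..i r}) = r"
      using card_strict_mono_image_atMost[OF assms(2) that] assms(3) by simp
    have "i r \<in> F" using assms(3) that by blast
    then show "i r \<le> n" using assms(1) by auto
    have "card (F \<inter> {..i r}) \<le> card {1..i r}" using assms(1) by (intro card_mono) auto
    then show "r \<le> i r" using r by simp
  qed
  have gen_iff: "H \<in> borel_generated n {{q..i (k + q - 1)} |q. q \<in> {1..d - k + 1}} \<longleftrightarrow>
      (\<exists>q\<in>{1..d - k + 1}. H \<subseteq> {1..i (k + q - 1)} \<and> card H = i (k + q - 1) + 1 - q)"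
    (is "_ \<in> borel_generated n ?\<G> \<longleftrightarrow> ?R") if k: "k \<in> {1..d}" for H k
  proof -
    have q: "k + q - 1 \<in> {1..d}" "q \<le> i (k + q - 1)" "i (k + q - 1) \<le> n"
      if "q \<in> {1..d - k + 1}" for q
    proof -
      show *: "k + q - 1 \<in> {1..d}" using that k by auto
      show "q \<le> i (k + q - 1)" using le_i[OF *] k by auto
      show "i (k + q - 1) \<le> n" using i_le[OF *] .
    qed
    have "?\<G> \<subseteq> Pow {1..n}" using q by fastforce
    then have "H \<in> borel_generated n ?\<G> \<longleftrightarrow>
        H \<subseteq> {1..n} \<and> (\<exists>q\<in>{1..d - k + 1}. gale_le H {q..i (k + q - 1)})"
      by (subst borel_generated_eq_gale) blast+
    also have "\<dots> \<longleftrightarrow> H \<subseteq> {1..n} \<and> ?R"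
      using q by (intro conj_cong bex_cong gale_le_atLeastAtMost_iff) auto
    also have "\<dots> \<longleftrightarrow> ?R" using q by fastforce
    finally show ?thesis .
  qed
  have "?Y \<subseteq> ?X"
  proof safe
    fix H k assume k: "k \<in> {1..d}"
      and "H \<in> borel_generated n {{q..i (k + q - 1)} |q. q \<in> {1..d - k + 1}}"
    then obtain q where q: "q \<in> {1..d - k + 1}"
      and H: "H \<subseteq> {1..i (k + q - 1)}" "card H = i (k + q - 1) + 1 - q"
      using gen_iff by blast
    let ?p = "i (k + q - 1)" and ?c = "\<lambda>j. of_bool (j \<in> H) :: nat"
    have r: "k + q - 1 \<in> {1..d}" using q k by auto
    have Hn: "H \<subseteq> {1..n}" using H i_le[OF r] by auto
    have fin: "finite H" using Hn finite_subset by blast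
    have supp: "{j. ?c j \<noteq> 0} = H" by auto
    have "card ({1..?p} - H) = ?p - card H" using H fin by (simp add: card_Diff_subset)
    also have "\<dots> = q - 1" using H(2) le_i[OF r] q k by auto
    finally have "card ({1..?p} - {j. ?c j \<noteq> 0}) + k \<le> card (F \<inter> {..?p})"
      unfolding supp rank[OF r] using q by simp
    then have "\<forall>G\<in>facets \<Delta>. k \<le> sum ?c G" using k by (subst cover_iff) auto
    moreover have "H \<noteq> {}" using H(2) le_i[OF r] k by auto
    ultimately have "squarefree_cover n \<Delta> k ?c"
      using Hn by (auto simp: squarefree_cover_def is_cover_def)
    moreover have "x_set H = (x_pow n ?c :: 'k mpol)"
      using Hn by (subst x_pow_squarefree) (auto simp: supp)
    ultimately show "\<exists>c k'. (monom (x_set H) k :: 'k mpol poly) = monom (x_pow n c) k' \<and>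
        k' \<ge> 1 \<and> squarefree_cover n \<Delta> k' c"
      using k by (intro exI[of _ ?c] exI[of _ k]) auto
  qed
  \<comment> \<open>Two families generate the same subalgebra as soon as the same subalgebras contain them, so
    the argument takes place inside an arbitrary subalgebra \<open>A\<close>.\<close>
  moreover have "?X \<subseteq> A" if A: "is_subalgebra n A" "?Y \<subseteq> A" for A
  proof safe
    fix c k assume k: "1 \<le> k" and c: "squarefree_cover n \<Delta> k c"
    let ?C = "{j. c j \<noteq> 0}"
    have c1: "\<And>j. c j \<le> 1" and c0: "\<And>j. j \<notin> {1..n} \<Longrightarrow> c j = 0"
      using c by (auto simp: squarefree_cover_def is_cover_def)
    have Cn: "?C \<subseteq> {1..n}" using c0 by (metis (mono_tags) mem_Collect_eq subsetI)
    obtain x where x: "card ({1..x} - ?C) + k \<le> card (F \<inter> {..x})"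
      using c cover_iff[OF k c1] by (auto simp: squarefree_cover_def is_cover_def)
    define r where "r = card (F \<inter> {..x})"
    have r: "r \<le> d" "i r \<le> x"
      using strict_mono_image_card_le[OF assms(2), of r x] x k assms(3) by (auto simp: r_def)
    \<comment> \<open>The index with \<open>k + q - 1 = r\<close>; it is positive because \<open>k \<le> r\<close>.\<close>
    define q where "q = r + 1 - k"
    have kr: "k \<le> r" using x by (simp add: r_def)
    have q: "q \<in> {1..d - k + 1}" "k + q - 1 = r" using kr r by (auto simp: q_def)
    have kd: "k \<in> {1..d}" using k kr r by auto
    have "card ({1..i r} - ?C) \<le> card ({1..x} - ?C)" using r by (intro card_mono) auto
    also have "\<dots> \<le> q - 1" using x by (simp add: q_def r_def)
    finally have "card ({1..i r} - ?C) \<le> q - 1" .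
    moreover have "card {1..i r} \<le> card ({1..i r} - ?C) + card ({1..i r} \<inter> ?C)"
      using card_Un_le[of "{1..i r} - ?C" "{1..i r} \<inter> ?C"] by (simp add: Un_Diff_Int)
    ultimately have "i r + 1 - q \<le> card ({1..i r} \<inter> ?C)"
      using q(1) by simp linarith
    then obtain H where H: "H \<subseteq> {1..i r} \<inter> ?C" "card H = i r + 1 - q"
      using obtain_subset_with_card_n by metis
    have "H \<in> borel_generated n {{q..i (k + q - 1)} |q. q \<in> {1..d - k + 1}}"
      using gen_iff[OF kd] H q by auto
    then have "monom (x_set H) k \<in> A" using A(2) kd by blast
    moreover have "(x_set (?C - H) :: 'k mpol) \<in> poly_ring n"
      using Cn by (intro x_set_in_poly_ring) auto
    ultimately have "smult (x_set (?C - H)) (monom (x_set H) k) \<in> A"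
      using A(1) by (auto simp: is_subalgebra_def)
    moreover have "x_set (?C - H) * x_set H = (x_pow n c :: 'k mpol)"
      unfolding x_pow_squarefree[OF c1 Cn] x_set_def using H(1) finite_subset[OF Cn]
      by (intro prod.subset_diff[symmetric]) auto
    ultimately show "(monom (x_pow n c) k :: 'k mpol poly) \<in> A" by (simp add: smult_monom)
  qed
  ultimately have "is_subalgebra n A \<and> ?X \<subseteq> A \<longleftrightarrow> is_subalgebra n A \<and> ?Y \<subseteq> A" for A
    by (meson subset_trans)
  then have "is_subalgebra n hull ?X = is_subalgebra n hull ?Y"
    unfolding hull_def by simp
  then show ?thesis
    unfolding cover_algebra_def subalgebra_generated_def .
qed

end
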